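(* Let $E$ be a finite-dimensional real vector space and let $K\subseteq E$ be a decomposable, pointed, convex cone. The irreducible decompositions of $K$ are identical modulo indexing: if $K=\bigoplus_{i=1}^m K_i$ with $K_i\subseteq E_i$, $E=\bigoplus_{i=1}^m E_i$, and $K=\bigoplus_{j=1}^q C_j$ with $C_j\subseteq F_j$, $E=\bigoplus_{j=1}^q F_j$, are two decompositions of $K$ into irreducible direct summands, then $m=q$ and, after reindexing, $K_i=C_i$ for all $i$. Moreover, the subspaces corresponding to the non-zero cones are also unique (i.e. after this reindexing $E_i=F_i$ whenever $K_i\neq\{0\}$). In particular, if $K$ is solid, then all the cones $K_i$ are non-zero and the subspaces $E_i$ are unique.
   Context: A cone is a subset containing $0$ and closed under multiplication by positive scalars. A cone is pointed if it contains no whole line, and solid if it has non-empty interior in $E$. For subspaces $\{0\}\neq E_i\subseteq E$, we write $E=E_1\oplus\cdots\oplus E_m$ if $E=E_1+\cdots+E_m$ and $E_i\cap\sum_{j\ne i}E_j=\{0\}$ for all $i$. A pointed convex cone $K\subseteq E$ is called decomposable if there are $m\ge 2$, non-zero linear subspaces $E_1,\dots,E_m$ of $E$ with $E=E_1\oplus\cdots\oplus E_m$, and cones $K_i\subseteq E_i$ such that $K=K_1+\cdots+K_m$ (Minkowski sum). One then writes $K=K_1\oplus\cdots\oplus K_m$ and calls the $K_i$ direct summands of $K$. Cones $K_i=\{0\}$ are allowed as summands. $K$ is called indecomposable (irreducible) if it is not decomposable. In a decomposition, irreducibility of the summand $K_i$ is understood with respect to the ambient space $E_i$ (so a zero summand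 $K_i=\{0\}$ is irreducible exactly when $\dim E_i=1$). An irreducible decomposition of $K$ is a decomposition $K=K_1\oplus\cdots\oplus K_m$ in which every $K_i$ is irreducible. *)

theory Defs
  imports "HOL-Analysis.Analysis" "HOL-Library.Set_Algebras"
begin

text \<open>Sums of sets, binary and indexed, are Minkowski sums (HOL-Library.Set_Algebras).
  The ambient space is always an explicit linear subspace \<open>V\<close>, because irreducibility of a
  direct summand refers to its own component space.\<close>

text \<open>The library's \<^const>\<open>cone\<close> means closed under non-negative scalars and admits the empty set;
  adding \<open>0 \<in> K\<close> makes this closure under positive scalars.\<close>

definition is_cone :: "'a::real_vector set \<Rightarrow> bool" where
  "is_cone K \<longleftrightarrow> 0 \<in> K \<and> cone K"

text \<open>Lines are taken through the origin, so a pointed convex cone is one with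
  \<open>K \<inter> (- K) = {0}\<close>. For non-closed cones this admits more cones than forbidding
  all affine lines; see \<open>pointed_if_no_affine_line\<close>.\<close>

definition pointed :: "'a::real_vector set \<Rightarrow> bool" where
  "pointed K \<longleftrightarrow> \<not> (\<exists>v. v \<noteq> 0 \<and> range (\<lambda>t. t *\<^sub>R v) \<subseteq> K)"

lemma pointed_if_no_affine_line:
  assumes "\<not> (\<exists>x v. v \<noteq> 0 \<and> range (\<lambda>t. x + t *\<^sub>R v) \<subseteq> K)"
  shows "pointed K"
  unfolding pointed_def
proof
  assume "\<exists>v. v \<noteq> 0 \<and> range (\<lambda>t. t *\<^sub>R v) \<subseteq> K"
  then obtain v where "v \<noteq> 0" "range (\<lambda>t. 0 + t *\<^sub>R v) \<subseteq> K"
    by auto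
  with assms show False by blast
qed

definition solid_in :: "'a::real_normed_vector set \<Rightarrow> 'a set \<Rightarrow> bool" where
  "solid_in V K \<longleftrightarrow> (top_of_set V) interior_of K \<noteq> {}"

definition direct_sum_of :: "'a::real_vector set \<Rightarrow> nat \<Rightarrow> (nat \<Rightarrow> 'a set) \<Rightarrow> bool" where
  "direct_sum_of V m W \<longleftrightarrow>
     (\<forall>i\<in>{1..m}. subspace (W i) \<and> W i \<noteq> {0}) \<and>
     V = (\<Sum>i\<in>{1..m}. W i) \<and>
     (\<forall>i\<in>{1..m}. W i \<inter> (\<Sum>j\<in>{1..m} - {i}. W j) = {0})"

definition cone_decomposition ::
  "'a::real_vector set \<Rightarrow> 'a set \<Rightarrow> nat \<Rightarrow> (nat \<Rightarrow> 'a set) \<Rightarrow> (nat \<Rightarrow> 'a set) \<Rightarrow> bool" where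
  "cone_decomposition V K m W C \<longleftrightarrow>
     m \<ge> 2 \<and> direct_sum_of V m W \<and>
     (\<forall>i\<in>{1..m}. is_cone (C i) \<and> C i \<subseteq> W i) \<and>
     K = (\<Sum>i\<in>{1..m}. C i)"

text \<open>The next three notions are meant for pointed convex cones \<open>K \<subseteq> V\<close>; direct summands of such
  a cone are again pointed convex cones.\<close>

definition decomposable_in :: "'a::real_vector set \<Rightarrow> 'a set \<Rightarrow> bool" where
  "decomposable_in V K \<longleftrightarrow> (\<exists>m W C. cone_decomposition V K m W C)"

definition irreducible_in :: "'a::real_vector set \<Rightarrow> 'a set \<Rightarrow> bool" where
  "irreducible_in V K \<longleftrightarrow> \<not> decomposable_in V K"

definition irreducible_decomposition ::
  "'a::real_vector set \<Rightarrow> 'a set \<Rightarrow> nat \<Rightarrow> (nat \<Rightarrow> 'a set) \<Rightarrow> (nat \<Rightarrow> 'a set) \<Rightarrow> bool" where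
  "irreducible_decomposition V K m W C \<longleftrightarrow>
     cone_decomposition V K m W C \<and> (\<forall>i\<in>{1..m}. irreducible_in (W i) (C i))"

end

theory Submission
  imports Defs
begin

text \<open>
  Pointedness is what makes the summands of a cone canonical: in \<open>K = P + Q\<close> with \<open>P\<close> and \<open>Q\<close> in
  independent subspaces, \<open>P\<close> is a face of \<open>K\<close> (\<open>summand_face\<close>). If \<open>x\<close> and \<open>y\<close> lie in \<open>K\<close> and \<open>x + y\<close>
  lies in \<open>P\<close>, then the \<open>Q\<close>-components of \<open>x\<close> and \<open>y\<close> are opposite elements of \<open>K\<close>, hence zero.

  Now compare \<open>K = P + Q\<close> with a second decomposition \<open>K = C + D\<close>. A sum \<open>c + d\<close> that lies in the
  face \<open>P\<close> has both terms in \<open>P\<close>, so \<open>P\<close> is the sum of \<open>P \<inter> C\<close> and \<open>P \<inter> D\<close>, again in independent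
  subspaces. If \<open>P\<close> is irreducible and meets \<open>C\<close> outside \<open>0\<close>, the second part vanishes and \<open>P \<subseteq> C\<close>
  (\<open>irreducible_summand_subset_if_meets\<close>). A non-zero irreducible summand of one decomposition
  therefore lies in a summand of the other, and by symmetry also conversely; since distinct
  summands meet only in \<open>0\<close>, the two inclusions are equalities (\<open>nonzero_summands_match\<close>).

  The ambient subspaces follow because an irreducible cone cannot lie in a proper non-zero
  subspace \<open>S\<close> of its space: a complement of \<open>S\<close>, carrying the zero cone, would split off
  (\<open>irreducible_spans\<close>). So a non-zero irreducible cone spans its space, which is thereby
  determined, and an irreducible zero cone lives on a line. Consequently the number of zero
  summands is \<open>dim E - dim K\<close> (\<open>zero_summand_count\<close>), the same in both decompositions, and
  the matching of the non-zero summands extends to a permutation of all indices. A solid cone lies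
  in no proper subspace, so none of its summands is zero.
\<close>

section \<open>Minkowski sums of subspaces and of cones\<close>

lemma is_cone_sum:
  assumes "finite I" "\<And>i. i \<in> I \<Longrightarrow> is_cone (C i)"
  shows "is_cone (\<Sum>i\<in>I. C i)"
  using assms
proof (induction I rule: finite_induct)
  case empty
  then show ?case by (simp add: is_cone_def cone_def)
next
  case (insert i I)
  then have C: "is_cone (C i)" and S: "is_cone (\<Sum>j\<in>I. C j)"
    by auto
  have "cone (C i + (\<Sum>j\<in>I. C j))"
    using C S unfolding is_cone_def cone_def
    by (auto elim!: set_plus_elim simp: scaleR_add_right intro!: set_plus_intro)
  moreover have "0 + 0 \<in> C i + (\<Sum>j\<in>I. C j)"
    using C S unfolding is_cone_def by blast
  ultimately show ?case
    using insert.hyps by (simp add: is_cone_def)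
qed

lemma subspace_set_plus:
  assumes "subspace A" "subspace B"
  shows "subspace (A + B)"
proof -
  have "A + B = {x + y | x y. x \<in> A \<and> y \<in> B}"
    by (auto simp: set_plus_def)
  then show ?thesis using subspace_sums[OF assms] by simp
qed

lemma subspace_sum_set:
  assumes "finite I" "\<And>i. i \<in> I \<Longrightarrow> subspace (W i)"
  shows "subspace (\<Sum>i\<in>I. W i)"
  using assms
  by (induction I rule: finite_induct) (simp_all add: subspace_set_plus)

lemma sum_set_mono:
  fixes A B :: "'i \<Rightarrow> 'a::comm_monoid_add set"
  assumes "finite I" "\<And>i. i \<in> I \<Longrightarrow> A i \<subseteq> B i"
  shows "(\<Sum>i\<in>I. A i) \<subseteq> (\<Sum>i\<in>I. B i)"
  using assms by (induction I rule: finite_induct) (simp_all add: set_plus_mono2)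

lemma set_plus_minimal_subspace:
  assumes "subspace S" "A \<subseteq> S" "B \<subseteq> S"
  shows "A + B \<subseteq> S"
  using assms by (auto elim!: set_plus_elim intro: subspace_add)

lemma sum_set_minimal_subspace:
  assumes "finite I" "subspace S" "\<And>i. i \<in> I \<Longrightarrow> W i \<subseteq> S"
  shows "(\<Sum>i\<in>I. W i) \<subseteq> S"
  using assms
  by (induction I rule: finite_induct) (simp_all add: set_plus_minimal_subspace subspace_0)

lemma subset_set_plus:
  fixes A B :: "'a::comm_monoid_add set"
  assumes "0 \<in> A" "0 \<in> B"
  shows "A \<subseteq> A + B" "B \<subseteq> A + B"
proof -
  show "A \<subseteq> A + B"
    using set_plus_intro[OF _ assms(2)] by fastforce
  show "B \<subseteq> A + B"
    using set_plus_intro[OF assms(1)] by fastforce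
qed

lemma subset_sum_set:
  fixes A :: "'i \<Rightarrow> 'a::comm_monoid_add set"
  assumes "finite I" "\<And>i. i \<in> I \<Longrightarrow> 0 \<in> A i" "j \<in> I"
  shows "A j \<subseteq> (\<Sum>i\<in>I. A i)"
proof -
  have "(\<Sum>i\<in>I - {j}. 0) \<in> (\<Sum>i\<in>I - {j}. A i)"
    unfolding set_sum_alt[OF finite_Diff[OF assms(1)]] using assms(2)
    by (intro CollectI exI[of _ "\<lambda>_. 0"]) auto
  then have "A j \<subseteq> A j + (\<Sum>i\<in>I - {j}. A i)"
    using assms by (intro subset_set_plus) auto
  also have "\<dots> = (\<Sum>i\<in>I. A i)"
    using assms by (intro sum.remove[symmetric])
  finally show ?thesis .
qed

lemma pointed_cone_antisym:
  assumes "is_cone K" "pointed K" "x \<in> K" "- x \<in> K"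
  shows "x = 0"
proof (rule ccontr)
  assume "x \<noteq> 0"
  have "t *\<^sub>R x \<in> K" for t :: real
  proof (cases "t \<ge> 0")
    case True
    then show ?thesis using assms unfolding is_cone_def cone_def by blast
  next
    case False
    then have "(- t) *\<^sub>R (- x) \<in> K"
      using assms unfolding is_cone_def cone_def by (metis le_minus_iff linear minus_zero)
    then show ?thesis by simp
  qed
  with \<open>x \<noteq> 0\<close> assms(2) show False
    unfolding pointed_def by blast
qed

section \<open>Irreducible cones\<close>

lemma decomposable_in_two:
  assumes "subspace A" "subspace B" "A \<noteq> {0}" "B \<noteq> {0}" "A \<inter> B = {0}"
    and "is_cone P" "is_cone Q" "P \<subseteq> A" "Q \<subseteq> B"
  shows "decomposable_in (A + B) (P + Q)"
proof -
  have I: "{1..2} = {1, 2::nat}" by auto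
  have d: "{1..2} - {1::nat} = {2}" "{1..2} - {2::nat} = {1}" by auto
  define W where "W i = (if i = (1::nat) then A else B)" for i
  define C where "C i = (if i = (1::nat) then P else Q)" for i
  have "W i \<inter> (\<Sum>j\<in>{1..2} - {i}. W j) = {0}" if "i \<in> {1..2}" for i
  proof -
    have "i = 1 \<or> i = 2" using that by auto
    then show ?thesis using assms(5) by (elim disjE)
      (simp_all only: d, simp_all add: W_def Int_commute)
  qed
  then have "cone_decomposition (A + B) (P + Q) 2 W C"
    using assms unfolding cone_decomposition_def direct_sum_of_def
    by (simp only: I) (simp add: W_def C_def)
  then show ?thesis unfolding decomposable_in_def by blast
qed

text \<open>The identity on a basis of \<open>S\<close> extends to a linear projection \<open>p\<close> of the whole space onto \<open>S\<close>;
  its kernel within \<open>V\<close> is a complement, by \<open>x = p x + (x - p x)\<close>.\<close>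

lemma subspace_complement:
  fixes S V :: "'a::real_vector set"
  assumes "subspace S" "subspace V" "S \<subseteq> V"
  obtains T where "subspace T" "S \<inter> T = {0}" "S + T = V"
proof -
  obtain B where B: "B \<subseteq> S" "independent B" "S \<subseteq> span B"
    using real_vector.maximal_independent_subset by blast
  have sB: "span B = S"
    using B assms(1) by (simp add: span_minimal subset_antisym)
  obtain p where p: "linear p" "\<And>x. x \<in> B \<Longrightarrow> p x = x" "range p \<subseteq> S"
    using linear_independent_extend_subspace[OF B(2), of "\<lambda>x. x"] sB by auto
  have pS: "p x = x" if "x \<in> S" for x
    using linear_eq_on_span[of p "\<lambda>x. x" B x] p that sB by (simp add: linear_ident)
  define T where "T = V \<inter> {x. p x = 0}"
  show ?thesis
  proof
    show "subspace T"
      unfolding T_def by (intro subspace_inter assms linear_subspace_kernel p)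
    show "S \<inter> T = {0}"
      using pS assms unfolding T_def by (auto simp: subspace_0)
    show "S + T = V"
    proof
      show "S + T \<subseteq> V"
        using assms by (intro set_plus_minimal_subspace) (auto simp: T_def)
      show "V \<subseteq> S + T"
      proof
        fix x assume x: "x \<in> V"
        have pxS: "p x \<in> S" using p(3) by blast
        then have "x - p x \<in> T"
          using x pS[of "p x"] assms p(1) unfolding T_def by (auto simp: linear_diff subspace_diff)
        with pxS have "p x + (x - p x) \<in> S + T" by (rule set_plus_intro)
        then show "x \<in> S + T" by simp
      qed
    qed
  qed
qed

text \<open>Otherwise \<open>V\<close> is the direct sum of \<open>S\<close> and a non-zero complement, and \<open>C = C + {0}\<close> is a
  decomposition along it. The cases \<open>S = span C\<close> and \<open>S = span {z}\<close>, the latter with \<open>C = {0}\<close>,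
  describe the spaces of the non-zero and of the zero irreducible cones.\<close>

lemma irreducible_spans:
  assumes "irreducible_in V C" "subspace V" "is_cone C"
    and "subspace S" "C \<subseteq> S" "S \<subseteq> V" "S \<noteq> {0}"
  shows "S = V"
proof -
  obtain T where T: "subspace T" "S \<inter> T = {0}" "S + T = V"
    using subspace_complement[OF assms(4,2,6)] .
  have "T = {0}"
  proof (rule ccontr)
    assume "T \<noteq> {0}"
    then have "decomposable_in (S + T) (C + {0})"
      using assms T by (intro decomposable_in_two) (auto simp: is_cone_def cone_def subspace_0)
    then show False
      using T(3) assms(1) unfolding irreducible_in_def by simp
  qed
  with T(3) show ?thesis by simp
qed

lemma span_irreducible:
  assumes "irreducible_in V C" "subspace V" "is_cone C" "C \<subseteq> V" "C \<noteq> {0}"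
  shows "span C = V"
proof (rule irreducible_spans[OF assms(1-3)])
  show "span C \<noteq> {0}"
    using assms(3,5) span_superset unfolding is_cone_def by fastforce
qed (auto simp: span_superset span_minimal assms)

lemma irreducible_zero_cone:
  assumes "irreducible_in V {0}" "subspace V" "z \<in> V" "z \<noteq> 0"
  shows "span {z} = V"
proof (rule irreducible_spans[OF assms(1,2)])
  show "span {z} \<noteq> {0}"
    using assms(4) span_base[of z "{z}"] by blast
  show "span {z} \<subseteq> V"
    using assms(2,3) by (intro span_minimal) auto
qed (auto simp: is_cone_def cone_def span_0)

section \<open>Direct summands are faces\<close>

text \<open>Write \<open>x = p + q\<close> and \<open>y = p' + q'\<close>. Then \<open>q + q'\<close> lies in both subspaces, so \<open>q' = - q\<close>;
  as both are elements of the pointed cone \<open>K\<close>, they vanish.\<close>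

lemma summand_face:
  assumes K: "is_cone K" "pointed K"
    and "subspace V" "subspace V'" "V \<inter> V' = {0}" "P \<subseteq> V" "Q \<subseteq> V'" "0 \<in> P" "0 \<in> Q" "K = P + Q"
    and "x \<in> K" "y \<in> K" "x + y \<in> P"
  shows "x \<in> P"
proof -
  obtain p q where x: "p \<in> P" "q \<in> Q" "x = p + q"
    using \<open>x \<in> K\<close> \<open>K = P + Q\<close> by (metis set_plus_elim)
  obtain p' q' where y: "p' \<in> P" "q' \<in> Q" "y = p' + q'"
    using \<open>y \<in> K\<close> \<open>K = P + Q\<close> by (metis set_plus_elim)
  have "q + q' = (x + y) - (p + p')" by (simp add: x y)
  moreover have "p + p' \<in> V"
    using assms(6) x(1) y(1) by (intro subspace_add[OF assms(3)]) auto
  moreover have "x + y \<in> V"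
    using assms(6,13) by blast
  moreover have "q + q' \<in> V'"
    using assms(7) x(2) y(2) by (intro subspace_add[OF assms(4)]) auto
  ultimately have "q + q' \<in> V \<inter> V'"
    using subspace_diff[OF assms(3)] by simp
  then have "q + q' = 0"
    using assms(5) by simp
  then have "q' = - q" by (simp add: add.commute eq_neg_iff_add_eq_0)
  moreover have "q \<in> K" "q' \<in> K"
    using x y subset_set_plus(2)[OF \<open>0 \<in> P\<close> \<open>0 \<in> Q\<close>] \<open>K = P + Q\<close> by auto
  ultimately have "q = 0"
    using pointed_cone_antisym[OF K] by simp
  with x show ?thesis by simp
qed

text \<open>The face property splits \<open>P\<close> into \<open>P \<inter> C\<close> and \<open>P \<inter> D\<close>, whose spans are independent because
  they lie in \<open>F\<close> and \<open>F'\<close>. They fill \<open>V\<close> because the irreducible cone \<open>P\<close>, being non-zero, spans it.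
  So this would be a decomposition of \<open>P\<close>, unless one of the two parts is zero; the point \<open>x\<close> tells
  which one.\<close>

lemma irreducible_summand_subset_if_meets:
  assumes K: "is_cone K" "pointed K"
    and P: "subspace V" "subspace V'" "V \<inter> V' = {0}" "P \<subseteq> V" "Q \<subseteq> V'" "is_cone P" "is_cone Q"
      "K = P + Q" "irreducible_in V P"
    and C: "subspace F" "subspace F'" "F \<inter> F' = {0}" "C \<subseteq> F" "D \<subseteq> F'" "is_cone C" "is_cone D" "K = C + D"
    and x: "x \<in> P" "x \<in> C" "x \<noteq> 0"
  shows "P \<subseteq> C"
proof -
  let ?A = "P \<inter> C" and ?B = "P \<inter> D"
  have P0: "0 \<in> P" and Q0: "0 \<in> Q" and C0: "0 \<in> C" and D0: "0 \<in> D"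
    using P(6,7) C(6,7) by (auto simp: is_cone_def)
  have CK: "C \<subseteq> K" and DK: "D \<subseteq> K"
    using subset_set_plus[OF C0 D0] C(8) by auto
  have PK: "P \<subseteq> K"
    using subset_set_plus(1)[OF P0 Q0] P(8) by simp
  have split: "c \<in> P \<and> d \<in> P" if "c \<in> C" "d \<in> D" "c + d \<in> P" for c d
    using summand_face[OF K P(1-5) P0 Q0 P(8), of c d] summand_face[OF K P(1-5) P0 Q0 P(8), of d c]
      that CK DK by (auto simp: add.commute)
  have PAB: "P = ?A + ?B"
  proof
    show "P \<subseteq> ?A + ?B"
    proof
      fix u assume u: "u \<in> P"
      then obtain c d where cd: "c \<in> C" "d \<in> D" "u = c + d"
        using PK C(8) by (metis set_plus_elim subsetD)
      then show "u \<in> ?A + ?B" using split[of c d] u by blast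
    qed
    show "?A + ?B \<subseteq> P"
    proof
      fix u assume "u \<in> ?A + ?B"
      then obtain c d where cd: "c \<in> ?A" "d \<in> ?B" "u = c + d" by (metis set_plus_elim)
      then have "u \<in> K" using C(8) by blast
      then obtain p q where pq: "p \<in> P" "q \<in> Q" "u = p + q"
        using P(8) by (metis set_plus_elim)
      have "u \<in> V" using cd P(1,4) by (auto intro: subspace_add)
      then have "u - p \<in> V" using pq P(4) by (intro subspace_diff[OF P(1)]) auto
      then have "q = 0" using pq P(3,5) by auto
      then show "u \<in> P" using pq by simp
    qed
  qed
  have V: "V = span ?A + span ?B"
  proof -
    have "span P = V"
      using span_irreducible[OF P(9,1,6,4)] x by blast
    moreover have "span P \<subseteq> span ?A + span ?B"
    proof (rule span_minimal)
      show "P \<subseteq> span ?A + span ?B"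
        by (subst PAB) (intro set_plus_mono2 span_superset)
    qed (intro subspace_set_plus subspace_span)
    moreover have "span ?A + span ?B \<subseteq> V"
      using P(1,4) by (intro set_plus_minimal_subspace span_minimal) auto
    ultimately show ?thesis by simp
  qed
  have disj: "span ?A \<inter> span ?B = {0}"
  proof -
    have "span ?A \<subseteq> F" "span ?B \<subseteq> F'"
      using C(1,2,4,5) by (intro span_minimal; blast)+
    then show ?thesis using C(3) by (auto simp: span_0)
  qed
  have "span ?B = {0}"
  proof (rule ccontr)
    assume "span ?B \<noteq> {0}"
    moreover have "span ?A \<noteq> {0}"
      using x span_base[of x ?A] by blast
    moreover have "is_cone ?A" "is_cone ?B"
      using P(6) C(6,7) by (auto simp: is_cone_def cone_def)
    ultimately have "decomposable_in (span ?A + span ?B) (?A + ?B)"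
      using disj by (intro decomposable_in_two) (auto simp: span_superset span_base)
    with P(9) V PAB show False unfolding irreducible_in_def by simp
  qed
  then have "?B \<subseteq> {0}" using span_superset[of ?B] by auto
  then have "?B = {0}" using P0 D0 by auto
  with PAB show ?thesis by auto
qed

section \<open>Matching the non-zero summands\<close>

text \<open>Grouping all summands but one reduces a decomposition to the two-term case treated above.\<close>

lemma cone_decomposition_isolate:
  assumes "cone_decomposition V K m W C" "i \<in> {1..m}"
  defines "W' \<equiv> \<Sum>j\<in>{1..m} - {i}. W j" and "C' \<equiv> \<Sum>j\<in>{1..m} - {i}. C j"
  shows "subspace (W i)" "subspace W'" "W i \<inter> W' = {0}" "C i \<subseteq> W i" "C' \<subseteq> W'"
    "is_cone (C i)" "is_cone C'" "K = C i + C'" "W i \<noteq> {0}"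
proof -
  note d = assms(1)[unfolded cone_decomposition_def direct_sum_of_def]
  show "subspace (W i)" "W i \<inter> W' = {0}" "C i \<subseteq> W i" "is_cone (C i)" "W i \<noteq> {0}"
    using d assms(2) by (auto simp: W'_def)
  show "subspace W'" "is_cone C'"
    using d unfolding W'_def C'_def by (auto intro!: subspace_sum_set is_cone_sum)
  show "C' \<subseteq> W'"
    using d unfolding W'_def C'_def by (intro sum_set_mono) auto
  show "K = C i + C'"
    using d assms(2) unfolding C'_def by (simp add: sum.remove)
qed

lemma summand_subset:
  assumes "cone_decomposition V K m W C" "i \<in> {1..m}"
  shows "C i \<subseteq> K" "W i \<subseteq> V"
proof -
  note d = assms(1)[unfolded cone_decomposition_def direct_sum_of_def]
  have "C i \<subseteq> (\<Sum>i\<in>{1..m}. C i)" "W i \<subseteq> (\<Sum>i\<in>{1..m}. W i)"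
    using d assms(2) by (intro subset_sum_set; simp add: is_cone_def subspace_0)+
  with d show "C i \<subseteq> K" "W i \<subseteq> V" by simp_all
qed

text \<open>A non-zero \<open>x \<in> C i\<close> has a non-zero component \<open>c j\<close> in the second decomposition. The face property
  puts \<open>c j\<close> into \<open>C i\<close>, so \<open>C i\<close> meets \<open>C' j\<close> outside \<open>0\<close>.\<close>

lemma irreducible_summand_in_summand:
  assumes K: "is_cone K" "pointed K"
    and D: "irreducible_decomposition V K m W C" "cone_decomposition V K q W' C'"
    and i: "i \<in> {1..m}" "C i \<noteq> {0}"
  shows "\<exists>j\<in>{1..q}. C i \<subseteq> C' j"
proof -
  have D1: "cone_decomposition V K m W C" and irr: "irreducible_in (W i) (C i)"
    using D(1) i(1) by (auto simp: irreducible_decomposition_def)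
  note a = cone_decomposition_isolate[OF D1 i(1)]
  have "0 \<in> C i" using a(6) by (simp add: is_cone_def)
  then obtain x where x: "x \<in> C i" "x \<noteq> 0" using i(2) by blast
  have "x \<in> (\<Sum>j\<in>{1..q}. C' j)"
    using x summand_subset(1)[OF D1 i(1)] D(2) by (auto simp: cone_decomposition_def)
  then obtain c where c: "x = sum c {1..q}" "\<And>j. j \<in> {1..q} \<Longrightarrow> c j \<in> C' j"
    unfolding set_sum_alt[OF finite_atLeastAtMost] by blast
  have "\<exists>j\<in>{1..q}. c j \<noteq> 0"
    using x(2) c(1) by (meson sum.neutral)
  then obtain j where j: "j \<in> {1..q}" "c j \<noteq> 0" by blast
  note b = cone_decomposition_isolate[OF D(2) j(1)]
  let ?r = "sum c ({1..q} - {j})"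
  have "?r \<in> (\<Sum>l\<in>{1..q} - {j}. C' l)"
    using c(2) by (subst set_sum_alt) auto
  then have "?r \<in> K"
    using b(6,8) subset_set_plus(2)[of "C' j"] b(7) by (auto simp: is_cone_def)
  moreover have "c j \<in> K"
    using summand_subset(1)[OF D(2) j(1)] c(2)[OF j(1)] by blast
  moreover have "c j + ?r \<in> C i"
    using x(1) c(1) j(1) by (simp add: sum.remove)
  ultimately have "c j \<in> C i"
    using summand_face[OF K a(1-5) \<open>0 \<in> C i\<close> _ a(8)] a(7) unfolding is_cone_def by blast
  then have "C i \<subseteq> C' j"
    using irreducible_summand_subset_if_meets[OF K a(1-8) irr b(1-8), of "c j"] c(2) j by blast
  then show ?thesis using j(1) by blast
qed

lemma nonzero_summand_inj:
  assumes "cone_decomposition V K m W C" "i \<in> {1..m}" "j \<in> {1..m}" "C i \<noteq> {0}" "C i \<subseteq> C j"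
  shows "i = j"
proof (rule ccontr)
  assume "i \<noteq> j"
  note a = cone_decomposition_isolate[OF assms(1,2)]
  note d = assms(1)[unfolded cone_decomposition_def direct_sum_of_def]
  let ?W' = "\<Sum>l\<in>{1..m} - {i}. W l"
  have "W j \<subseteq> ?W'"
    using d assms(3) \<open>i \<noteq> j\<close> by (intro subset_sum_set) (auto simp: subspace_0)
  then have "C i \<subseteq> ?W'"
    using assms(3,5) d by blast
  then have "C i \<subseteq> {0}" using a(3,4) by blast
  then show False using assms(4) a(6) by (auto simp: is_cone_def)
qed

text \<open>Going to the second decomposition and back gives \<open>C i \<subseteq> C' j \<subseteq> C l\<close>, and \<open>l = i\<close> because distinct
  summands of one decomposition have only \<open>0\<close> in common.\<close>

lemma nonzero_summands_match:
  assumes K: "is_cone K" "pointed K"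
    and D: "irreducible_decomposition V K m W C" "irreducible_decomposition V K q W' C'"
    and i: "i \<in> {1..m}" "C i \<noteq> {0}"
  shows "\<exists>j\<in>{1..q}. C i = C' j"
proof -
  have D': "cone_decomposition V K m W C" "cone_decomposition V K q W' C'"
    using D by (auto simp: irreducible_decomposition_def)
  obtain j where j: "j \<in> {1..q}" "C i \<subseteq> C' j"
    using irreducible_summand_in_summand[OF K D(1) D'(2) i] by blast
  have "0 \<in> C i" using cone_decomposition_isolate(6)[OF D'(1) i(1)] by (simp add: is_cone_def)
  with i(2) j(2) have "C' j \<noteq> {0}" by blast
  then obtain l where l: "l \<in> {1..m}" "C' j \<subseteq> C l"
    using irreducible_summand_in_summand[OF K D(2) D'(1) j(1)] by blast
  then have "i = l"
    using nonzero_summand_inj[OF D'(1) i(1) l(1) i(2)] j(2) by blast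
  with j l show ?thesis by blast
qed

section \<open>Counting the zero summands\<close>

text \<open>A basis \<open>A\<close> of the span of \<open>K\<close>, taken together with one non-zero vector \<open>z i\<close> for each zero
  summand, is a basis of \<open>V\<close>. It spans because non-zero summands span their spaces inside the span
  of \<open>K\<close> and zero summands live on lines.\<close>

lemma zero_summand_count:
  assumes D: "irreducible_decomposition V K m W C"
    and fin: "finite B" "span B = V"
  shows "dim V = dim K + card {i\<in>{1..m}. C i = {0}}"
proof -
  define Z where "Z = {i\<in>{1..m}. C i = {0}}"
  have D': "cone_decomposition V K m W C"
    using D by (simp add: irreducible_decomposition_def)
  note d = D'[unfolded cone_decomposition_def direct_sum_of_def]
  note iso = cone_decomposition_isolate[OF D']
  have irr: "irreducible_in (W i) (C i)" if "i \<in> {1..m}" for i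
    using D that by (simp add: irreducible_decomposition_def)
  have "\<exists>z. z \<in> W i \<and> z \<noteq> 0" if "i \<in> {1..m}" for i
    using iso(1,9)[OF that] subspace_0 by fastforce
  then obtain z where z: "\<And>i. i \<in> {1..m} \<Longrightarrow> z i \<in> W i \<and> z i \<noteq> 0" by metis
  have KV: "K \<subseteq> V"
  proof -
    have "(\<Sum>i\<in>{1..m}. C i) \<subseteq> (\<Sum>i\<in>{1..m}. W i)"
      using d by (intro sum_set_mono) auto
    with d show ?thesis by simp
  qed
  obtain A where A: "A \<subseteq> K" "independent A" "K \<subseteq> span A" "card A = dim K"
    by (rule real_vector.basis_exists)
  have finA: "finite A"
    using independent_span_bound[OF fin(1) A(2)] A(1) KV fin(2) by auto
  have spA: "span A = span K"
    using A(1,3) by (intro subset_antisym span_mono span_minimal) simp_all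
  have Zm: "Z \<subseteq> {1..m}" by (simp add: Z_def subset_iff)
  \<comment> \<open>Each new \<open>z i\<close> is independent of the earlier vectors: as \<open>C i = {0}\<close>, the cone \<open>K\<close> and the
    other \<open>z j\<close> lie in the sum of the spaces \<open>W j\<close> with \<open>j \<noteq> i\<close>, which meets \<open>W i\<close> only in \<open>0\<close>.\<close>
  have key: "independent (A \<union> z ` Y) \<and> card (A \<union> z ` Y) = card A + card Y"
    if "finite Y" "Y \<subseteq> Z" for Y
    using that
  proof (induction Y rule: finite_induct)
    case empty
    then show ?case using A(2) by simp
  next
    case (insert i Y)
    have i: "i \<in> {1..m}" "C i = {0}" using insert.prems by (auto simp: Z_def)
    let ?W' = "\<Sum>j\<in>{1..m} - {i}. W j"
    have "K \<subseteq> ?W'" using iso(5,8)[OF i(1)] i(2) by simp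
    moreover have "z j \<in> ?W'" if j: "j \<in> Y" for j
    proof -
      have jm: "j \<in> {1..m} - {i}" using j insert.prems insert.hyps Zm by auto
      have "W j \<subseteq> ?W'"
        using d jm by (intro subset_sum_set) (auto simp: subspace_0)
      then show ?thesis using z jm by blast
    qed
    ultimately have "span (A \<union> z ` Y) \<subseteq> ?W'"
      using A(1) iso(2)[OF i(1)] by (intro span_minimal) auto
    then have ni: "z i \<notin> span (A \<union> z ` Y)"
      using iso(3)[OF i(1)] z[OF i(1)] by blast
    then have "z i \<notin> A \<union> z ` Y" using span_base[of "z i" "A \<union> z ` Y"] by auto
    moreover have "independent (A \<union> z ` Y)" "card (A \<union> z ` Y) = card A + card Y"
      using insert.IH insert.prems by simp_all
    ultimately show ?case
      using ni finA insert.hyps by (simp add: independent_insert)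
  qed
  have Zfin: "finite Z" by (simp add: Z_def)
  have "V \<subseteq> span (A \<union> z ` Z)"
  proof -
    have "W i \<subseteq> span (A \<union> z ` Z)" if i: "i \<in> {1..m}" for i
    proof (cases "C i = {0}")
      case True
      then have "W i = span {z i}"
        using irreducible_zero_cone[of "W i" "z i"] irr[OF i] iso(1)[OF i] z[OF i] by simp
      also have "\<dots> \<subseteq> span (A \<union> z ` Z)"
        using True i by (intro span_mono) (auto simp: Z_def)
      finally show ?thesis .
    next
      case False
      then have "W i = span (C i)"
        using span_irreducible[OF irr[OF i]] iso[OF i] by simp
      also have "\<dots> \<subseteq> span A"
        unfolding spA using summand_subset(1)[OF D' i] by (rule span_mono)
      also have "\<dots> \<subseteq> span (A \<union> z ` Z)"
        by (intro span_mono) auto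
      finally show ?thesis .
    qed
    then have "(\<Sum>i\<in>{1..m}. W i) \<subseteq> span (A \<union> z ` Z)"
      by (intro sum_set_minimal_subspace) auto
    with d show ?thesis by simp
  qed
  moreover have "A \<union> z ` Z \<subseteq> V"
    using A(1) KV z Zm summand_subset(2)[OF D'] by blast
  ultimately have "dim V = card (A \<union> z ` Z)"
    using key[OF Zfin subset_refl] real_vector.basis_card_eq_dim[of "A \<union> z ` Z" V] by metis
  also have "\<dots> = dim K + card Z"
    using key[OF Zfin subset_refl] A(4) by simp
  finally show ?thesis by (simp add: Z_def)
qed

section \<open>Solid cones\<close>

text \<open>A relative interior point \<open>x\<close> of \<open>K\<close> can be moved a little in any direction \<open>v \<in> V\<close> inside \<open>K\<close>,
  so \<open>v\<close> is a multiple of the difference of two points of \<open>S\<close>.\<close>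

lemma solid_in_subspace:
  fixes V :: "'a::real_normed_vector set"
  assumes "subspace V" "solid_in V K" "subspace S" "K \<subseteq> S"
  shows "V \<subseteq> S"
proof
  fix v assume v: "v \<in> V"
  obtain x U where U: "openin (top_of_set V) U" "x \<in> U" "U \<subseteq> K"
    using assms(2) unfolding solid_in_def interior_of_def by blast
  then obtain e where e: "e > 0" "\<And>y. y \<in> V \<Longrightarrow> dist y x < e \<Longrightarrow> y \<in> U"
    unfolding openin_euclidean_subtopology_iff by blast
  have xV: "x \<in> V" using U(1,2) openin_imp_subset by blast
  \<comment> \<open>The \<open>1\<close> keeps \<open>r\<close> positive when \<open>v = 0\<close>.\<close>
  define r where "r = norm v + 1"
  have r: "r > 0" "norm v < r" by (simp_all add: r_def add_nonneg_pos)
  define t where "t = e / r"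
  have t: "t > 0" using e(1) r(1) by (simp add: t_def)
  have "t * norm v < t * r" using t r(2) by simp
  also have "\<dots> = e" using r(1) by (simp add: t_def)
  finally have "dist (x + t *\<^sub>R v) x < e" using t by (simp add: dist_norm)
  moreover have "x + t *\<^sub>R v \<in> V" using xV v assms(1) by (simp add: subspace_add subspace_scale)
  ultimately have "x + t *\<^sub>R v \<in> S" "x \<in> S" using e(2) U assms(4) by blast+
  then have "(x + t *\<^sub>R v) - x \<in> S" using assms(3) by (rule subspace_diff[rotated])
  then have "(1 / t) *\<^sub>R ((x + t *\<^sub>R v) - x) \<in> S" by (rule subspace_scale[OF assms(3)])
  moreover have "(1 / t) *\<^sub>R ((x + t *\<^sub>R v) - x) = v" using t by simp
  ultimately show "v \<in> S" by simp
qed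

text \<open>If \<open>C i\<close> were zero, \<open>K\<close> would lie in the sum of the other component spaces, which does not
  contain \<open>W i\<close>.\<close>

lemma solid_summand_nonzero:
  fixes V :: "'a::real_normed_vector set"
  assumes D: "cone_decomposition V K m W C" and "subspace V" "solid_in V K" "i \<in> {1..m}"
  shows "C i \<noteq> {0}"
proof
  assume z: "C i = {0}"
  note a = cone_decomposition_isolate[OF D assms(4)]
  let ?W' = "\<Sum>j\<in>{1..m} - {i}. W j"
  have "K \<subseteq> ?W'" using a(5,8) z by simp
  then have "V \<subseteq> ?W'" using solid_in_subspace assms(2,3) a(2) by blast
  then have "W i \<subseteq> ?W'" using summand_subset(2)[OF D assms(4)] by blast
  then show False using a(3,9) by blast
qed

section \<open>Uniqueness\<close>

theorem theorem4p3:
  fixes E K :: "'a::real_normed_vector set"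
    and m q :: nat
    and Es Ks Fs Cs :: "nat \<Rightarrow> 'a set"
  assumes "subspace E" and "\<exists>B. finite B \<and> span B = E"
    and "K \<subseteq> E" and "is_cone K" and "convex K" and "pointed K"
    and "decomposable_in E K"
    and "irreducible_decomposition E K m Es Ks"
    and "irreducible_decomposition E K q Fs Cs"
  shows "m = q \<and>
    (\<exists>\<sigma>. \<sigma> permutes {1..m} \<and>
      (\<forall>i\<in>{1..m}. Ks i = Cs (\<sigma> i)) \<and>
      (\<forall>i\<in>{1..m}. Ks i \<noteq> {0} \<longrightarrow> Es i = Fs (\<sigma> i)) \<and>
      (solid_in E K \<longrightarrow>
        (\<forall>i\<in>{1..m}. Ks i \<noteq> {0}) \<and> (\<forall>i\<in>{1..m}. Es i = Fs (\<sigma> i))))"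
proof -
  note K = assms(4,6) and D = assms(8,9)
  have D': "cone_decomposition E K m Es Ks" "cone_decomposition E K q Fs Cs"
    using D by (auto simp: irreducible_decomposition_def)
  define I J where "I = {i\<in>{1..m}. Ks i \<noteq> {0}}" and "J = {j\<in>{1..q}. Cs j \<noteq> {0}}"
  have injI: "inj_on Ks I" and injJ: "inj_on Cs J"
    using nonzero_summand_inj[OF D'(1)] nonzero_summand_inj[OF D'(2)]
    by (auto simp: inj_on_def I_def J_def)
  have img: "Ks ` I = Cs ` J"
  proof
    show "Ks ` I \<subseteq> Cs ` J"
      using nonzero_summands_match[OF K D] unfolding I_def J_def image_def by fastforce
    show "Cs ` J \<subseteq> Ks ` I"
      using nonzero_summands_match[OF K D(2,1)] unfolding I_def J_def image_def by fastforce
  qed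
  define f where "f = inv_into J Cs \<circ> Ks"
  have f: "bij_betw f I J"
    unfolding f_def using injI injJ img
    by (intro bij_betw_trans[of _ _ "Cs ` J"] bij_betw_inv_into) (auto simp: bij_betw_def)
  have Cf: "Cs (f i) = Ks i" if "i \<in> I" for i
    using that img by (auto simp: f_def intro!: f_inv_into_f)
  let ?ZI = "{i\<in>{1..m}. Ks i = {0}}" and ?ZJ = "{j\<in>{1..q}. Cs j = {0}}"
  obtain B where B: "finite B" "span B = E" using assms(2) by blast
  have "card ?ZI = card ?ZJ"
    using zero_summand_count[OF D(1) B] zero_summand_count[OF D(2) B] by simp
  then obtain g where g: "bij_betw g ?ZI ?ZJ"
    using finite_same_card_bij[of ?ZI ?ZJ] by auto
  have ZI: "{1..m} = I \<union> ?ZI" and ZJ: "{1..q} = J \<union> ?ZJ"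
    unfolding I_def J_def by blast+
  have "card I = card J" using bij_betw_same_card[OF f] .
  with \<open>card ?ZI = card ?ZJ\<close> have "card (I \<union> ?ZI) = card (J \<union> ?ZJ)"
    by (subst (1 2) card_Un_disjoint) (auto simp: I_def J_def)
  then have mq: "m = q" unfolding ZI[symmetric] ZJ[symmetric] by simp
  \<comment> \<open>Non-zero cones are matched by equality, zero cones arbitrarily.\<close>
  define \<sigma> where "\<sigma> i = (if i \<in> {1..m} then if i \<in> I then f i else g i else i)" for i
  have "bij_betw \<sigma> (I \<union> ?ZI) (J \<union> ?ZJ)"
  proof (rule bij_betw_combine)
    show "bij_betw \<sigma> I J"
      using f by (rule bij_betw_cong[THEN iffD1, rotated]) (auto simp: \<sigma>_def I_def)
    show "bij_betw \<sigma> ?ZI ?ZJ"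
      using g by (rule bij_betw_cong[THEN iffD1, rotated]) (auto simp: \<sigma>_def I_def)
  qed (auto simp: J_def)
  then have "bij_betw \<sigma> {1..m} {1..q}"
    unfolding ZI[symmetric] ZJ[symmetric] .
  then have perm: "\<sigma> permutes {1..m}"
    unfolding mq by (rule bij_imp_permutes) (simp_all only: \<sigma>_def mq if_False)
  have \<sigma>f: "\<sigma> i = f i" if "i \<in> I" for i using that by (auto simp: \<sigma>_def I_def)
  have cones: "Ks i = Cs (\<sigma> i)" if i: "i \<in> {1..m}" for i
  proof (cases "i \<in> I")
    case True
    then show ?thesis using Cf \<sigma>f by simp
  next
    case False
    then have "g i \<in> ?ZJ" "\<sigma> i = g i" "Ks i = {0}"
      using i bij_betwE[OF g] by (auto simp: \<sigma>_def I_def)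
    then show ?thesis by simp
  qed
  have spaces: "Es i = Fs (\<sigma> i)" if i: "i \<in> {1..m}" "Ks i \<noteq> {0}" for i
  proof -
    have j: "\<sigma> i \<in> {1..q}" using permutes_in_image[OF perm] i(1) mq by simp
    have "Es i = span (Ks i)"
      using span_irreducible[of "Es i" "Ks i"] cone_decomposition_isolate[OF D'(1) i(1)] D(1) i
      by (simp add: irreducible_decomposition_def)
    also have "\<dots> = Fs (\<sigma> i)"
      using span_irreducible[of "Fs (\<sigma> i)" "Cs (\<sigma> i)"] cone_decomposition_isolate[OF D'(2) j]
        D(2) j i cones[OF i(1)]
      by (simp add: irreducible_decomposition_def)
    finally show ?thesis .
  qed
  have solid: "Ks i \<noteq> {0}" if "solid_in E K" "i \<in> {1..m}" for i
    using solid_summand_nonzero[OF D'(1) assms(1) that] .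
  show ?thesis
    using mq perm cones spaces solid by (intro conjI exI[of _ \<sigma>] ballI impI) simp_all
qed

end
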